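(* Let $k_1,k_2\in\mathbb{D}$ and $s_1,s_2\in\mathbb{D}^*$ be given, let the moments $s_j=s_j^{(0)}+s_j^{(1)}\varepsilon\in\mathbb{D}$ for $j\ge3$ be generated recursively by $$s_j=k_1s_{j-1}+\sum_{i=1}^{j-1}s_is_{j-i}+k_2\sum_{i=1}^{j-2}s_is_{j-i-1},\qquad j\geq 3,$$ and let $\Delta_{-2}=\Delta_{-1}=\Delta_0=1$ and $$\Delta_{2k-1}=\det(s_{i+j-1})_{i,j=1,2,\dots,k},\qquad \Delta_{2k}=\det(s_{i+j})_{i,j=1,2,\dots,k},\qquad k\ge1.$$ Then $(\Delta_n)_{n\ge-2}$ is a solution of the dual Somos-5 recurrence $$\Delta_{n+3}\Delta_{n-2}=\alpha\,\Delta_{n+2}\Delta_{n-1}+\beta\,\Delta_{n+1}\Delta_n,\qquad n\ge0,$$ where the coefficients $\alpha=\alpha^{(0)}+\alpha^{(1)}\varepsilon$ and $\beta=\beta^{(0)}+\beta^{(1)}\varepsilon$ are given by $$\alpha^{(0)}=-k_2^{(0)}s_1^{(0)}-s_2^{(0)},\qquad \beta^{(0)}=k_2^{(0)}s_2^{(0)}+k_1^{(0)}s_2^{(0)}+k_2^{(0)}\big(s_1^{(0)}\big)^2+2s_1^{(0)}s_2^{(0)},$$ $$\alpha^{(1)}=-k_2^{(0)}s_1^{(1)}-k_2^{(1)}s_1^{(0)}-s_2^{(1)},$$ $$\beta^{(1)}=k_2^{(0)}s_2^{(1)}+k_2^{(1)}s_2^{(0)}+k_1^{(1)}s_2^{(0)}+k_1^{(0)}s_2^{(1)}+k_2^{(1)}\big(s_1^{(0)}\big)^2+2k_2^{(0)}s_1^{(1)}s_1^{(0)}+2s_1^{(1)}s_2^{(0)}+2s_1^{(0)}s_2^{(1)},$$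 and the components of the resulting dual first integral $J=J^{(0)}+J^{(1)}\varepsilon$ take the values $$J^{(i)}=k_1^{(i)}+2s_1^{(i)}\qquad\text{for } i=0,1.$$
   Context: $\mathbb{D}=\{x+y\varepsilon: x,y\in\mathbb{C},\ \varepsilon^2=0\}$ is the commutative ring of dual numbers, and $\mathbb{D}^*=\{x+y\varepsilon: x\ne0\}$ is its group of units. The components of a dual number $a$ are written $a=a^{(0)}+a^{(1)}\varepsilon$. The first integral $J\in\mathbb{D}$ of a dual Somos-5 sequence $(X_n)$ with $X_nX_{n+5}=\alpha X_{n+1}X_{n+4}+\beta X_{n+2}X_{n+3}$ is the conserved (i.e. $n$-independent) quantity defined by $$X_nX_{n+1}X_{n+2}X_{n+3}X_{n+4}\,J=X_n^2X_{n+3}^2X_{n+4}+X_nX_{n+1}^2X_{n+4}^2+\alpha\left(X_{n+1}^2X_{n+2}^2X_{n+4}+X_nX_{n+2}^2X_{n+3}^2\right)+\beta X_{n+1}X_{n+2}^3X_{n+3}.$$ It is determined by any five consecutive terms that are units; for the sequence $X_n=\Delta_n$ one may use $\Delta_{-2},\Delta_{-1},\Delta_0,\Delta_1,\Delta_2$, which are units. *)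

theory Defs
  imports Complex_Main "Jordan_Normal_Form.Determinant"
begin

text \<open>\<open>Dual x y\<close> stands for \<open>x + y\<epsilon>\<close> with \<open>x, y \<in> \<complex>\<close> and \<open>\<epsilon>\<^sup>2 = 0\<close>.\<close>

datatype dual = Dual (std_part: complex) (eps_part: complex)

lemma dual_eq_iff: "a = b \<longleftrightarrow> std_part a = std_part b \<and> eps_part a = eps_part b"
  by (cases a; cases b) simp

instantiation dual :: comm_ring_1
begin

definition zero_dual :: dual where
  "0 = Dual 0 0"

definition one_dual :: dual where
  "1 = Dual 1 0"

definition plus_dual :: "dual \<Rightarrow> dual \<Rightarrow> dual" where
  "a + b = Dual (std_part a + std_part b) (eps_part a + eps_part b)"

definition uminus_dual :: "dual \<Rightarrow> dual" where
  "- a = Dual (- std_part a) (- eps_part a)"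

definition minus_dual :: "dual \<Rightarrow> dual \<Rightarrow> dual" where
  "a - b = Dual (std_part a - std_part b) (eps_part a - eps_part b)"

definition times_dual :: "dual \<Rightarrow> dual \<Rightarrow> dual" where
  "a * b = Dual (std_part a * std_part b)
                (std_part a * eps_part b + eps_part a * std_part b)"

instance
  by standard
    (simp_all add: zero_dual_def one_dual_def plus_dual_def uminus_dual_def minus_dual_def
      times_dual_def algebra_simps)

end

definition dual_units :: "dual set" where
  "dual_units = {a. std_part a \<noteq> 0}"

lemma dual_units_iff_dvd_1: "a \<in> dual_units \<longleftrightarrow> a dvd 1"
proof
  assume "a \<in> dual_units"
  then have "1 = a * Dual (1 / std_part a) (- eps_part a / (std_part a * std_part a))"
    by (simp add: dual_units_def one_dual_def times_dual_def field_simps)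
  then show "a dvd 1" by (rule dvdI)
next
  assume "a dvd 1"
  then obtain b where "1 = a * b" by (rule dvdE)
  then show "a \<in> dual_units"
    by (auto simp: dual_units_def one_dual_def times_dual_def)
qed

text \<open>\<open>J\<close> is a first integral of the sequence \<open>X\<close> indexed by \<open>n \<ge> m\<close>: one and the same
  \<open>J\<close> satisfies the defining equation for every window of five consecutive terms.  The equation
  is kept in cleared form because the terms of a dual sequence need not be units; a window of
  units determines \<open>J\<close>.\<close>

definition somos5_first_integral ::
  "'a::comm_ring_1 \<Rightarrow> 'a \<Rightarrow> int \<Rightarrow> (int \<Rightarrow> 'a) \<Rightarrow> 'a \<Rightarrow> bool" where
  "somos5_first_integral \<alpha> \<beta> m X J \<longleftrightarrow>
     (\<forall>n\<ge>m. X n * X (n+1) * X (n+2) * X (n+3) * X (n+4) * J =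
        (X n)^2 * (X (n+3))^2 * X (n+4) + X n * (X (n+1))^2 * (X (n+4))^2
        + \<alpha> * ((X (n+1))^2 * (X (n+2))^2 * X (n+4) + X n * (X (n+2))^2 * (X (n+3))^2)
        + \<beta> * X (n+1) * (X (n+2))^3 * X (n+3))"

end

(* Put f = sum_j s (j+1) x^j.  The recursion for the moments is a quadratic equation for f over
   polynomials in x of degree at most 2.  If f = a / (1 - x g), then g satisfies a quadratic equation
   of the same shape, and the Hankel determinants of f are those of g, shifted by one place and
   multiplied by powers of a.  Expanding f into a Stieltjes fraction with coefficients a_n thus gives
   Delta_(n+1) Delta_(n-2) = a_n Delta_n Delta_(n-1), while the induced map on the coefficients of the
   quadratic equation is a QRT map for (a_n, a_(n+1)) whose invariants are alpha, beta and J.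

   The expansion divides by the a_n, so it needs a field in which no Delta_n vanishes.  Given dual
   parameters x + y eps are lifted to polynomials x + y t + (v - x - y) t^2, which reduce to them
   modulo t^2 and take the value v at t = 1.  With v = 0, 0, 1, 1 for k1, k2, s_1, s_2, the moments at
   t = 1 are the Catalan numbers, whose Hankel determinants are all 1, so no Delta_n is zero in C(t). *)

theory Submission
  imports Defs "HOL-Computational_Algebra.Formal_Power_Series"
    "HOL-Computational_Algebra.Polynomial_Factorial"
begin

unbundle fps_syntax
no_notation vec_index (infixl "$" 100)

section \<open>Hankel determinants under one step of a Stieltjes fraction\<close>

definition hankel_det :: "(nat \<Rightarrow> 'a::comm_ring_1) \<Rightarrow> nat \<Rightarrow> nat \<Rightarrow> 'a" where
  "hankel_det f e k = det (mat k k (\<lambda>(i, j). f (i + j + e)))"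

text \<open>\<open>tau f (m + 2)\<close> is \<open>\<Delta>\<^sub>m\<close> for \<open>f j = s (j + 1)\<close>; at \<open>m \<le> 0\<close> the determinant is empty.\<close>

definition tau :: "(nat \<Rightarrow> 'a::comm_ring_1) \<Rightarrow> nat \<Rightarrow> 'a" where
  "tau f n = hankel_det f (if even n then 1 else 0) ((n - 1) div 2)"

text \<open>As generating functions, \<open>f = f 0 / (1 - x g)\<close>.\<close>

definition stieltjes_step :: "(nat \<Rightarrow> 'a::comm_ring_1) \<Rightarrow> (nat \<Rightarrow> 'a) \<Rightarrow> bool" where
  "stieltjes_step f g \<longleftrightarrow> (\<forall>n. f (Suc n) = (\<Sum>m\<le>n. f (n - m) * g m))"

text \<open>Cut the convolution at \<open>m = j\<close>: the terms below move to the left, the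
  others are reindexed. The sides are then entries of the Hankel matrices
  \<open>f (i + j + 1)\<close> and \<open>g (i + j)\<close> multiplied by the Toeplitz matrices of
  \<open>1 - x g\<close> and \<open>f\<close>.\<close>

lemma stieltjes_step_shift:
  assumes "stieltjes_step f g"
  shows "f (Suc (p + j)) - (\<Sum>q<j. g (j - Suc q) * f (Suc (p + q))) = (\<Sum>m\<le>p. f (p - m) * g (m + j))"
proof -
  have split: "{..p + j} = {..<j} \<union> (\<lambda>m. m + j) ` {..p}"
  proof -
    have "x \<in> (\<lambda>m. m + j) ` {..p}" if "x \<le> p + j" "\<not> x < j" for x
      using that by (intro image_eqI[of _ _ "x - j"]) auto
    then show ?thesis by auto
  qed
  have "f (Suc (p + j)) = (\<Sum>m\<le>p + j. f (p + j - m) * g m)"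
    using assms by (simp add: stieltjes_step_def)
  also have "\<dots> = (\<Sum>m<j. f (p + j - m) * g m) + (\<Sum>m\<in>(\<lambda>m. m + j) ` {..p}. f (p + j - m) * g m)"
    unfolding split by (rule sum.union_disjoint) auto
  also have "(\<Sum>m<j. f (p + j - m) * g m) = (\<Sum>q<j. g (j - Suc q) * f (Suc (p + q)))"
    by (subst sum.nat_diff_reindex[symmetric]) (auto intro!: sum.cong simp: mult.commute Suc_diff_Suc)
  also have "(\<Sum>m\<in>(\<lambda>m. m + j) ` {..p}. f (p + j - m) * g m) = (\<Sum>m\<le>p. f (p - m) * g (m + j))"
    by (subst sum.reindex) (auto simp: inj_on_def)
  finally show ?thesis by simp
qed

text \<open>Matrix of multiplication by the power series with coefficients \<open>f\<close>, modulo
  x^k.\<close>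

definition toeplitz :: "nat \<Rightarrow> (nat \<Rightarrow> 'a::comm_ring_1) \<Rightarrow> 'a mat" where
  "toeplitz k f = mat k k (\<lambda>(i, j). if j \<le> i then f (i - j) else 0)"

lemma toeplitz_carrier [simp]: "toeplitz k f \<in> carrier_mat k k"
  by (simp add: toeplitz_def)

lemma det_toeplitz: "det (toeplitz k f) = f 0 ^ k"
proof -
  have "det (toeplitz k f) = prod_list (diag_mat (toeplitz k f))"
    by (rule det_lower_triangular[where n = k]) (auto simp: toeplitz_def)
  also have "\<dots> = f 0 ^ k"
    by (simp add: prod_list_diag_prod toeplitz_def)
  finally show ?thesis .
qed

lemma mult_transpose_toeplitz:
  fixes A :: "'a::comm_ring_1 mat"
  assumes A: "A \<in> carrier_mat k k" and "i < k" "j < k"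
    and u: "u 0 = 1" "\<And>n. u (Suc n) = - g n"
  shows "(A * transpose_mat (toeplitz k u)) $$ (i, j) = A $$ (i, j) - (\<Sum>q<j. g (j - Suc q) * A $$ (i, q))"
proof -
  have "(A * transpose_mat (toeplitz k u)) $$ (i, j)
      = (\<Sum>q\<in>{0..<k}. A $$ (i, q) * (if q \<le> j then u (j - q) else 0))"
    using assms by (auto simp: scalar_prod_def toeplitz_def intro!: sum.cong)
  also have "\<dots> = (\<Sum>q<Suc j. A $$ (i, q) * u (j - q))"
    using \<open>j < k\<close> by (intro sum.mono_neutral_cong_right) auto
  also have "\<dots> = A $$ (i, j) + (\<Sum>q<j. A $$ (i, q) * u (j - q))"
    by (simp add: u)
  also have "(\<Sum>q<j. A $$ (i, q) * u (j - q)) = (\<Sum>q<j. - (g (j - Suc q) * A $$ (i, q)))"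
    by (intro sum.cong) (auto simp: u Suc_diff_Suc[symmetric] simp del: Suc_diff_Suc)
  finally show ?thesis by (simp add: sum_negf)
qed

lemma toeplitz_mult:
  fixes A :: "'a::comm_ring_1 mat"
  assumes A: "A \<in> carrier_mat k k" and "i < k" "j < k"
  shows "(toeplitz k f * A) $$ (i, j) = (\<Sum>m\<le>i. f (i - m) * A $$ (m, j))"
proof -
  have "(toeplitz k f * A) $$ (i, j) = (\<Sum>m\<in>{0..<k}. (if m \<le> i then f (i - m) else 0) * A $$ (m, j))"
    using assms by (auto simp: scalar_prod_def toeplitz_def intro!: sum.cong)
  also have "\<dots> = (\<Sum>m\<le>i. f (i - m) * A $$ (m, j))"
    using \<open>i < k\<close> by (intro sum.mono_neutral_cong_right) auto
  finally show ?thesis .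
qed

text \<open>The hypothesis says \<open>A U\<^sup>T = F B\<close> with the Toeplitz matrices \<open>U\<close> of \<open>1 - x g\<close> and \<open>F\<close> of \<open>f\<close>.\<close>

lemma det_eq_of_toeplitz:
  fixes A B :: "'a::comm_ring_1 mat"
  assumes A: "A \<in> carrier_mat k k" and B: "B \<in> carrier_mat k k"
    and eq: "\<And>i j. i < k \<Longrightarrow> j < k \<Longrightarrow>
      A $$ (i, j) - (\<Sum>q<j. g (j - Suc q) * A $$ (i, q)) = (\<Sum>m\<le>i. f (i - m) * B $$ (m, j))"
  shows "det A = f 0 ^ k * det B"
proof -
  define u where "u n = (case n of 0 \<Rightarrow> 1 | Suc m \<Rightarrow> - g m)" for n
  have u: "u 0 = 1" "\<And>n. u (Suc n) = - g n" by (simp_all add: u_def)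
  have "A * transpose_mat (toeplitz k u) = toeplitz k f * B"
  proof (rule eq_matI)
    fix i j assume "i < dim_row (toeplitz k f * B)" "j < dim_col (toeplitz k f * B)"
    then have "i < k" "j < k" using B by (auto simp: toeplitz_def)
    then show "(A * transpose_mat (toeplitz k u)) $$ (i, j) = (toeplitz k f * B) $$ (i, j)"
      using mult_transpose_toeplitz[OF A _ _ u] toeplitz_mult[OF B] eq by simp
  qed (use A B in \<open>auto simp: toeplitz_def\<close>)
  then have "det (A * transpose_mat (toeplitz k u)) = det (toeplitz k f * B)" by simp
  then show ?thesis
    using A B by (simp add: det_mult[of _ k] det_transpose[of _ k] det_toeplitz u)
qed

lemma hankel_det_1_step:
  assumes "stieltjes_step f g"
  shows "hankel_det f 1 k = f 0 ^ k * hankel_det g 0 k"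
  unfolding hankel_det_def
  by (rule det_eq_of_toeplitz[where g = g]) (simp_all add: stieltjes_step_shift[OF assms])

text \<open>Column operations by \<open>1 - x g\<close> turn the first row into \<open>f 0\<close>
  followed by zeros. Hence \<open>B\<close> splits into a 1 and the shifted Hankel matrix of
  \<open>g\<close>, one size smaller.\<close>

lemma hankel_det_0_step:
  assumes step: "stieltjes_step f g"
  shows "hankel_det f 0 (Suc k) = f 0 ^ Suc k * hankel_det g 1 k"
proof -
  define B where "B = mat (Suc k) (Suc k) (\<lambda>(i, j).
    if i = 0 \<or> j = 0 then (if i = j then 1 else 0) else g (i + j - 1))"
  have B: "B \<in> carrier_mat (Suc k) (Suc k)" by (simp add: B_def)
  have f_Suc: "f (Suc n) = (\<Sum>m\<le>n. f (n - m) * g m)" for n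
    using step by (simp add: stieltjes_step_def)
  have entries: "f (i + j) - (\<Sum>q<j. g (j - Suc q) * f (i + q)) = (\<Sum>m\<le>i. f (i - m) * B $$ (m, j))"
    if "i < Suc k" "j < Suc k" for i j
  \<comment> \<open>Row 0 is the defining convolution itself. In row \<open>p + 1\<close> the border
    of \<open>B\<close> leaves only the term \<open>m = 0\<close> when \<open>j = 0\<close>, and
    removes exactly that term when \<open>j > 0\<close>.\<close>
  proof (cases i)
    case 0
    have "(\<Sum>q<Suc n. g (n - q) * f q) = (\<Sum>m\<le>n. f (n - m) * g m)" for n
      by (subst sum.nat_diff_reindex[symmetric]) (auto intro!: sum.cong simp: lessThan_Suc_atMost mult.commute)
    then show ?thesis
      using 0 that by (cases j) (simp_all add: B_def f_Suc del: sum.lessThan_Suc)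
  next
    case (Suc p)
    have "f (i + j) - (\<Sum>q<j. g (j - Suc q) * f (i + q)) = (\<Sum>m\<le>p. f (p - m) * g (m + j))"
      using stieltjes_step_shift[OF step, of p j] Suc by simp
    also have "\<dots> = (\<Sum>m\<le>i. f (i - m) * B $$ (m, j))"
    proof (cases j)
      case 0
      have "(\<Sum>m\<le>i. f (i - m) * B $$ (m, j)) = f i * B $$ (0, j) + (\<Sum>m\<le>p. f (p - m) * B $$ (Suc m, j))"
        by (simp only: Suc sum.atMost_Suc_shift diff_Suc_Suc diff_zero)
      moreover have "(\<Sum>m\<le>p. f (p - m) * B $$ (Suc m, j)) = 0"
        using that Suc 0 by (intro sum.neutral) (auto simp: B_def)
      ultimately show ?thesis using that 0 Suc f_Suc[of p] by (simp add: B_def)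
    next
      case (Suc j')
      have "(\<Sum>m\<le>i. f (i - m) * B $$ (m, j)) = f i * B $$ (0, j) + (\<Sum>m\<le>p. f (p - m) * B $$ (Suc m, j))"
        by (simp only: \<open>i = Suc p\<close> sum.atMost_Suc_shift diff_Suc_Suc diff_zero)
      moreover have "B $$ (0, j) = 0" using that Suc by (simp add: B_def)
      moreover have "(\<Sum>m\<le>p. f (p - m) * B $$ (Suc m, j)) = (\<Sum>m\<le>p. f (p - m) * g (m + j))"
        using that Suc \<open>i = Suc p\<close> by (intro sum.cong) (auto simp: B_def)
      ultimately show ?thesis by simp
    qed
    finally show ?thesis .
  qed
  have "hankel_det f 0 (Suc k) = f 0 ^ Suc k * det B"
    unfolding hankel_det_def
    by (rule det_eq_of_toeplitz[where g = g]) (simp_all add: B entries)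
  also have "det B = (\<Sum>j<Suc k. B $$ (0, j) * cofactor B 0 j)"
    by (rule laplace_expansion_row[OF B]) simp
  also have "\<dots> = (\<Sum>j\<in>{0}. B $$ (0, j) * cofactor B 0 j)"
    by (rule sum.mono_neutral_right) (auto simp: B_def)
  also have "\<dots> = det (mat_delete B 0 0)"
    by (simp add: B_def cofactor_def)
  also have "mat_delete B 0 0 = mat k k (\<lambda>(i, j). g (i + j + 1))"
    by (rule eq_matI) (auto simp: B_def mat_delete_def)
  finally show ?thesis by (simp add: hankel_det_def)
qed

text \<open>Shifted and unshifted determinants alternate with the parity of \<open>n\<close>, which
  merges the two cases; \<open>n div 2\<close> is the size of the matrix on the left. At
  \<open>n = 0\<close> truncated subtraction makes both matrices empty.\<close>

lemma tau_Suc_step: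
  assumes "stieltjes_step f g"
  shows "tau f (Suc n) = f 0 ^ (n div 2) * tau g n"
proof (cases "even n")
  case True
  then obtain k where k: "n = 2 * k" by blast
  show ?thesis
  proof (cases k)
    case 0
    then show ?thesis by (simp add: k tau_def hankel_det_def)
  next
    case (Suc l)
    have "(2 * Suc l - 1) div 2 = l" by simp
    then show ?thesis
      using hankel_det_0_step[OF assms, of l] by (simp add: k Suc tau_def)
  qed
next
  case False
  then obtain k where k: "n = 2 * k + 1" using oddE by blast
  show ?thesis using hankel_det_1_step[OF assms, of k] by (simp add: k tau_def)
qed

lemma tau_small [simp]: "tau f 0 = 1" "tau f (Suc 0) = 1" "tau f 2 = 1" "tau f 3 = f 0" "tau f 4 = f 1"
  by (simp_all add: tau_def hankel_det_def det_single)

text \<open>Passing from \<open>F i\<close> to its tail lowers \<open>n\<close> by one and extracts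
  the same total power of \<open>F i 0\<close> on both sides, so the induction needs no
  division.\<close>

lemma tau_ratio:
  fixes F :: "nat \<Rightarrow> nat \<Rightarrow> 'a::comm_ring_1"
  assumes "\<And>i. stieltjes_step (F i) (F (Suc i))"
  shows "tau (F i) (n + 3) * tau (F i) n = F (i + n) 0 * tau (F i) (n + 2) * tau (F i) (n + 1)"
proof (induction n arbitrary: i)
  case 0
  then show ?case by (simp add: tau_def hankel_det_def det_single)
next
  case (Suc n)
  let ?a = "F i 0" and ?t = "tau (F (Suc i))"
  have t: "tau (F i) (Suc m) = ?a ^ (m div 2) * ?t m" for m
    by (rule tau_Suc_step[OF assms])
  have e: "(n + 3) div 2 + n div 2 = (n + 2) div 2 + (n + 1) div 2"
    by (cases "even n") (auto elim!: evenE oddE)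
  have "tau (F i) (Suc n + 3) * tau (F i) (Suc n)
      = ?a ^ ((n + 3) div 2 + n div 2) * (?t (n + 3) * ?t n)"
    by (simp only: add_Suc t power_add mult_ac)
  also have "\<dots> = ?a ^ ((n + 2) div 2 + (n + 1) div 2) * (F (Suc i + n) 0 * ?t (n + 2) * ?t (n + 1))"
    by (simp only: Suc.IH e)
  also have "\<dots> = F (i + Suc n) 0 * tau (F i) (Suc n + 2) * tau (F i) (Suc n + 1)"
    by (simp only: add_Suc add_Suc_right t power_add mult_ac)
  finally show ?case .
qed


section \<open>The quadratic equation along the Stieltjes fraction\<close>

text \<open>The linear coefficient is written with \<open>J - 2 a\<close> so that \<open>J\<close> is preserved by \<open>quad_step\<close>.\<close>

definition quad :: "'a::field \<Rightarrow> 'a \<Rightarrow> 'a \<Rightarrow> 'a \<Rightarrow> 'a fps \<Rightarrow> bool" where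
  "quad J p a c f \<longleftrightarrow> (1 + fps_const p * fps_X) * fps_X * f\<^sup>2
     - (1 - fps_const (J - 2 * a) * fps_X) * f + (fps_const a + fps_const c * fps_X) = 0"

lemma quad_nth:
  assumes "quad J p a c f"
  shows "f $ 0 = a" and "f $ 1 = a * (J - a) + c"
proof -
  \<comment> \<open>The left side of \<open>quad\<close>, with factors \<open>fps_X\<close> moved to
    the front so that the coefficients of order 0 and 1 can be read off.\<close>
  define E where "E = fps_X * (f\<^sup>2 + fps_const p * (fps_X * f\<^sup>2)) - f + fps_X * (fps_const (J - 2 * a) * f)
    + fps_const a + fps_X * fps_const c"
  have E: "E = 0"
    using assms by (simp add: quad_def E_def algebra_simps)
  have "E $ 0 = 0" by (simp add: E)
  then show a: "f $ 0 = a" by (simp add: E_def)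
  have "E $ 1 = 0" by (simp add: E)
  then show "f $ 1 = a * (J - a) + c"
    by (simp add: E_def a power2_eq_square fps_mult_nth_0 algebra_simps)
qed

text \<open>Substituting \<open>f = a / w\<close> with \<open>w = 1 - x g\<close>, clearing
  \<open>w\<close> and dividing by \<open>a\<close> gives a quadratic equation for \<open>w\<close>;
  the form \<open>a * d\<close> of the last coefficient makes this division exact. Written in
  \<open>g\<close>, its constant term cancels, and dividing by x restores the shape of
  \<open>quad\<close>.\<close>

lemma quad_step:
  fixes f g :: "'a::field fps"
  assumes a: "a \<noteq> 0" and fg: "f * (1 - fps_X * g) = fps_const a"
    and quad: "quad J p a (a * d) f"
  shows "quad J d (d + J - a) (a * p) g"
proof -
  define A D P K where "A = fps_const a" and "D = fps_const d" and "P = fps_const p"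
    and "K = fps_const J"
  note cdefs = A_def D_def P_def K_def
  define w where "w = 1 - fps_X * g"
  have fw: "f * w = A" using fg by (simp add: w_def A_def)
  have A0: "A \<noteq> 0" using a by (simp add: A_def)
  have two: "fps_const (2 * x) = 2 * fps_const x" for x :: 'a
    by (simp only: mult_2 fps_const_add)
  have const_eqs: "fps_const (J - 2 * a) = K - 2 * A" "fps_const (a * d) = A * D"
    "fps_const (d + J - a) = D + K - A" "fps_const (J - 2 * (d + J - a)) = K - 2 * (D + K - A)"
    "fps_const (a * p) = A * P"
    by (simp_all only: cdefs two fps_const_sub[symmetric] fps_const_add[symmetric] fps_const_mult)
  have q: "(1 + P * fps_X) * fps_X * f\<^sup>2 - (1 - (K - 2 * A) * fps_X) * f + (A + A * D * fps_X) = 0"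
    using quad unfolding quad_def const_eqs by (simp only: cdefs)
  have "A * ((1 + P * fps_X) * fps_X * A - (1 - (K - 2 * A) * fps_X) * w + (1 + D * fps_X) * w\<^sup>2)
      = w\<^sup>2 * ((1 + P * fps_X) * fps_X * f\<^sup>2 - (1 - (K - 2 * A) * fps_X) * f + (A + A * D * fps_X))"
    unfolding fw[symmetric] by (simp add: algebra_simps power2_eq_square)
  also have "\<dots> = 0" using q by simp
  finally have q': "(1 + P * fps_X) * fps_X * A - (1 - (K - 2 * A) * fps_X) * w + (1 + D * fps_X) * w\<^sup>2 = 0"
    using A0 by simp
  have "fps_X * ((1 + D * fps_X) * fps_X * g\<^sup>2 - (1 - (K - 2 * (D + K - A)) * fps_X) * g
      + ((D + K - A) + (A * P) * fps_X)) =
      (1 + P * fps_X) * fps_X * A - (1 - (K - 2 * A) * fps_X) * w + (1 + D * fps_X) * w\<^sup>2"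
    unfolding w_def by (simp add: algebra_simps power2_eq_square)
  also have "\<dots> = 0" by (rule q')
  finally have "(1 + D * fps_X) * fps_X * g\<^sup>2 - (1 - (K - 2 * (D + K - A)) * fps_X) * g
      + ((D + K - A) + (A * P) * fps_X) = 0"
    by simp
  then show ?thesis
    unfolding quad_def const_eqs by (simp only: cdefs)
qed

text \<open>Solves \<open>f = f $ 0 / (1 - x g)\<close> for \<open>g\<close>. If
  \<open>f $ 0\<close> is nonzero, the shifted series has no constant term, so the shift is division
  by x.\<close>

definition next_fps :: "'a::field fps \<Rightarrow> 'a fps" where
  "next_fps f = fps_shift 1 (1 - fps_const (f $ 0) * inverse f)"

lemma next_fps:
  assumes "f $ 0 \<noteq> 0"
  shows "f * (1 - fps_X * next_fps f) = fps_const (f $ 0)"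
proof -
  have "fps_X * next_fps f = 1 - fps_const (f $ 0) * inverse f"
    using assms by (intro fps_ext) (simp add: next_fps_def fps_X_mult_nth)
  then show ?thesis
    using assms by (simp add: inverse_mult_eq_1' mult.left_commute[of f])
qed

lemma stieltjes_step_fps:
  assumes "f * (1 - fps_X * g) = fps_const a"
  shows "stieltjes_step (fps_nth f) (fps_nth g)"
  unfolding stieltjes_step_def
proof
  fix n
  have "f = fps_const a + fps_X * (g * f)"
    using assms by (simp add: algebra_simps)
  then have "f $ Suc n = (fps_const a + fps_X * (g * f)) $ Suc n" by simp
  also have "\<dots> = (g * f) $ n" by simp
  also have "\<dots> = (\<Sum>m\<le>n. f $ (n - m) * g $ m)"
    by (simp only: fps_mult_nth atLeast0AtMost mult.commute[of "g $ _"])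
  finally show "f $ Suc n = (\<Sum>m\<le>n. f $ (n - m) * g $ m)" .
qed

text \<open>Nonvanishing of all \<open>tau\<close> passes to the tails and keeps every
  \<open>a n\<close> nonzero, so the expansion never stops. The last relation equates the
  coefficient \<open>a n * P n\<close> produced by \<open>quad_step\<close> with the value
  \<open>a (n + 1) * P (n + 2)\<close> read off from the order x of
  \<open>F (n + 1)\<close>.\<close>

lemma stieltjes_chain:
  fixes f :: "'a::field fps"
  assumes quad: "quad J p (f $ 0) c f" and nz: "\<And>m. tau (fps_nth f) m \<noteq> 0"
  obtains F a P where "F 0 = f" "\<And>n. stieltjes_step (fps_nth (F n)) (fps_nth (F (Suc n)))"
    "\<And>n. F n $ 0 = a n" "P 0 = p" "\<And>n. P (Suc n) = a n + a (Suc n) - J"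
    "\<And>n. a (Suc n) * P (Suc (Suc n)) = a n * P n"
proof -
  define F where "F n = (next_fps ^^ n) f" for n
  define a where "a n = F n $ 0" for n
  define P where "P n = (case n of 0 \<Rightarrow> p | Suc m \<Rightarrow> a m + a (Suc m) - J)" for n
  have F_Suc: "F (Suc n) = next_fps (F n)" for n by (simp add: F_def)
  \<comment> \<open>This value is the \<open>d\<close> of \<open>quad_step\<close>: comparing
    \<open>F n $ 1 = a n * a (n + 1)\<close> with \<open>a n * (J - a n) + c\<close> gives
    \<open>c = a n * P (n + 1)\<close>.\<close>
  have P_Suc: "P (Suc n) = a n + a (Suc n) - J" for n by (simp add: P_def)
  \<comment> \<open>Index 3 is where \<open>tau\<close> equals the leading coefficient.\<close>
  have step: "F n * (1 - fps_X * F (Suc n)) = fps_const (a n)" if "\<And>m. tau (fps_nth (F n)) m \<noteq> 0" for n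
    using that[of 3] next_fps[of "F n"] by (simp add: F_Suc a_def)
  have c_eq: "c' = a n * P (Suc n)"
    if "\<And>m. tau (fps_nth (F n)) m \<noteq> 0" "quad J p' (a n) c' (F n)" for n p' c'
  proof -
    have "F n $ 1 = a n * a (Suc n)"
      using stieltjes_step_fps[OF step[OF that(1)]] by (simp add: stieltjes_step_def a_def)
    with quad_nth(2)[OF that(2)] show ?thesis
      by (simp add: P_Suc algebra_simps)
  qed
  have next_quad: "quad J (P (Suc n)) (a (Suc n)) (a n * P n) (F (Suc n))"
    if nz': "\<And>m. tau (fps_nth (F n)) m \<noteq> 0" and q: "quad J (P n) (a n) (a n * P (Suc n)) (F n)" for n
  proof -
    have "a n \<noteq> 0" using nz'[of 3] by (simp add: a_def)
    from quad_step[OF this step[OF nz'] q] show ?thesis by (simp add: P_Suc)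
  qed
  have inv: "(\<forall>m. tau (fps_nth (F n)) m \<noteq> 0) \<and> quad J (P n) (a n) (a n * P (Suc n)) (F n)" for n
  proof (induction n)
    case 0
    have "c = a 0 * P (Suc 0)"
      by (rule c_eq) (use nz quad in \<open>simp_all add: F_def a_def\<close>)
    then show ?case using nz quad by (simp add: F_def a_def P_def)
  next
    case (Suc n)
    \<comment> \<open>A zero of \<open>tau\<close> for the tail would give a zero for
      \<open>F n\<close> one index higher.\<close>
    have nz': "tau (fps_nth (F (Suc n))) m \<noteq> 0" for m
      using Suc tau_Suc_step[OF stieltjes_step_fps[OF step], of n m] by (metis mult_zero_right)
    have "quad J (P (Suc n)) (a (Suc n)) (a n * P n) (F (Suc n))"
      by (rule next_quad) (use Suc in auto)
    with nz' c_eq[OF nz' this] show ?case by simp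
  qed
  show thesis
  proof (rule that)
    show "F 0 = f" by (simp add: F_def)
    show "stieltjes_step (fps_nth (F n)) (fps_nth (F (Suc n)))" for n
      using inv by (intro stieltjes_step_fps[OF step]) auto
    show "F n $ 0 = a n" for n by (simp add: a_def)
    show "P 0 = p" by (simp add: P_def)
    show "P (Suc n) = a n + a (Suc n) - J" for n by (rule P_Suc)
    show "a (Suc n) * P (Suc (Suc n)) = a n * P n" for n
      using c_eq[OF _ next_quad] inv by auto
  qed
qed

section \<open>Somos-5 and its first integral from QRT invariants\<close>

definition somos5_with_integral :: "'a::comm_ring_1 \<Rightarrow> 'a \<Rightarrow> 'a \<Rightarrow> (nat \<Rightarrow> 'a) \<Rightarrow> bool" where
  "somos5_with_integral \<alpha> \<beta> J T \<longleftrightarrow> (\<forall>n.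
     T (n+5) * T n = \<alpha> * T (n+4) * T (n+1) + \<beta> * T (n+3) * T (n+2) \<and>
     T n * T (n+1) * T (n+2) * T (n+3) * T (n+4) * J =
       (T n)^2 * (T (n+3))^2 * T (n+4) + T n * (T (n+1))^2 * (T (n+4))^2
       + \<alpha> * ((T (n+1))^2 * (T (n+2))^2 * T (n+4) + T n * (T (n+2))^2 * (T (n+3))^2)
       + \<beta> * T (n+1) * (T (n+2))^3 * T (n+3))"

text \<open>Here \<open>a\<close>, \<open>b\<close>, \<open>c\<close> are consecutive Stieltjes
  coefficients. The ratios reduce the recurrence, multiplied by \<open>x2\<close>, to the scalar
  relation \<open>s\<close>, and the integral equation to the scalar relation
  \<open>J\<close>.\<close>

lemma somos5_window:
  fixes x0 :: "'a::idom"
  assumes r: "x3 * x0 = a * x2 * x1" "x4 * x1 = b * x3 * x2" "x5 * x2 = c * x4 * x3" and "x2 \<noteq> 0"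
    and s: "a * b * c = \<alpha> * b + \<beta>" and J: "a * b * J = a * b * (a + b) + \<alpha> * (a + b) + \<beta>"
  shows "x5 * x0 = \<alpha> * x4 * x1 + \<beta> * x3 * x2"
    and "x0 * x1 * x2 * x3 * x4 * J = x0^2 * x3^2 * x4 + x0 * x1^2 * x4^2
      + \<alpha> * (x1^2 * x2^2 * x4 + x0 * x2^2 * x3^2) + \<beta> * x1 * x2^3 * x3"
proof -
  have "x2 * (x5 * x0) = (x5 * x2) * x0" by simp
  also have "\<dots> = c * x4 * (x3 * x0)" by (simp add: r)
  also have "\<dots> = c * a * x2 * (x4 * x1)" by (simp add: r(1))
  also have "\<dots> = x2 * ((a * b * c) * x3 * x2)" by (simp add: r(2))
  also have "\<dots> = x2 * ((\<alpha> * b + \<beta>) * x3 * x2)" by (simp only: s)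
  also have "\<dots> = x2 * (\<alpha> * (b * x3 * x2) + \<beta> * x3 * x2)" by (simp add: algebra_simps)
  also have "\<dots> = x2 * (\<alpha> * x4 * x1 + \<beta> * x3 * x2)" by (simp add: r(2)[symmetric])
  finally show "x5 * x0 = \<alpha> * x4 * x1 + \<beta> * x3 * x2" using \<open>x2 \<noteq> 0\<close> by simp
  show "x0 * x1 * x2 * x3 * x4 * J = x0^2 * x3^2 * x4 + x0 * x1^2 * x4^2
      + \<alpha> * (x1^2 * x2^2 * x4 + x0 * x2^2 * x3^2) + \<beta> * x1 * x2^3 * x3"
  proof -
    \<comment> \<open>Up to the factors \<alpha>, \<beta> and \<open>J\<close>, every monomial of
      the integral equation is \<open>?m\<close> times a polynomial in \<open>a\<close> and
      \<open>b\<close>.\<close>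
    let ?m = "x1 * x2^3 * x3"
    have "x0 * x1 * x2 * x3 * x4 * J = (x3 * x0) * (x4 * x1) * x2 * J" by (simp only: mult_ac)
    also have "\<dots> = ?m * (a * b * J)"
      unfolding r(1) r(2) by (simp only: power3_eq_cube mult_ac)
    also have "\<dots> = ?m * (a * b * (a + b) + \<alpha> * (a + b) + \<beta>)" by (simp only: J)
    finally have lhs: "x0 * x1 * x2 * x3 * x4 * J = ?m * (a * b * (a + b) + \<alpha> * (a + b) + \<beta>)" .
    have "x0^2 * x3^2 * x4 = (x3 * x0) * (x3 * x0) * x4" by (simp only: power2_eq_square mult_ac)
    also have "\<dots> = a * a * x2 * x2 * x1 * (x4 * x1)" unfolding r(1) by (simp only: mult_ac)
    also have "\<dots> = a * a * b * ?m" unfolding r(2) by (simp only: power3_eq_cube mult_ac)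
    finally have t1: "x0^2 * x3^2 * x4 = a * a * b * ?m" .
    have "x0 * x1^2 * x4^2 = x0 * (x4 * x1) * (x4 * x1)" by (simp only: power2_eq_square mult_ac)
    also have "\<dots> = b * b * x3 * x2 * x2 * (x3 * x0)" unfolding r(2) by (simp only: mult_ac)
    also have "\<dots> = a * b * b * ?m" unfolding r(1) by (simp only: power3_eq_cube mult_ac)
    finally have t2: "x0 * x1^2 * x4^2 = a * b * b * ?m" .
    have "x1^2 * x2^2 * x4 = x1 * x2 * x2 * (x4 * x1)" by (simp only: power2_eq_square mult_ac)
    also have "\<dots> = b * ?m" unfolding r(2) by (simp only: power3_eq_cube mult_ac)
    finally have t3: "x1^2 * x2^2 * x4 = b * ?m" .
    have "x0 * x2^2 * x3^2 = x2 * x2 * x3 * (x3 * x0)" by (simp only: power2_eq_square mult_ac)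
    also have "\<dots> = a * ?m" unfolding r(1) by (simp only: power3_eq_cube mult_ac)
    finally have t4: "x0 * x2^2 * x3^2 = a * ?m" .
    show ?thesis
      unfolding lhs t1 t2 t3 t4 by (simp add: algebra_simps)
  qed
qed

text \<open>Replacing \<open>x * p\<close> by \<open>y * (y + z - J)\<close> turns each claim into a
  polynomial identity in \<open>x\<close>, \<open>y\<close>, \<open>z\<close>, \<open>J\<close>. The
  two conserved quantities are the future -\<alpha> and \<beta>.\<close>

lemma qrt_invariants:
  fixes x y z p q J :: "'a::comm_ring_1"
  assumes q: "q = x + y - J" and r: "r = y + z - J" and yr: "y * r = x * p"
  shows "x * (p + y) = y * (q + z)"
    and "x * (y * J + (x + y) * p) = y * (z * J + (y + z) * q)"
    and "x * y * z = - (x * (p + y)) * y + x * (y * J + (x + y) * p)"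
proof -
  have xp: "x * p = y * (y + z - J)" using yr r by simp
  have "x * (p + y) = x * p + x * y" by (simp only: distrib_left)
  then show "x * (p + y) = y * (q + z)"
    unfolding xp q by (simp add: algebra_simps)
  have "x * (y * J + (x + y) * p) = x * y * J + (x + y) * (x * p)" by (simp add: algebra_simps)
  then show "x * (y * J + (x + y) * p) = y * (z * J + (y + z) * q)"
    unfolding xp q by (simp add: algebra_simps)
  have "- (x * (p + y)) * y + x * (y * J + (x + y) * p) = x * (x * p) - x * y * y + x * y * J"
    by (simp add: algebra_simps)
  then show "x * y * z = - (x * (p + y)) * y + x * (y * J + (x + y) * p)"
    unfolding xp by (simp add: algebra_simps)
qed

text \<open>Conservation allows the invariants to be evaluated at the start of the fraction, where
  they depend only on \<open>p\<close>, \<open>J\<close> and the first two coefficients of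
  \<open>f\<close>.\<close>

lemma hankel_somos5_field:
  fixes f :: "'a::field fps"
  assumes quad: "quad J p (f $ 0) c f" and nz: "\<And>m. tau (fps_nth f) m \<noteq> 0"
  defines "\<alpha> \<equiv> - p * f $ 0 - f $ 1"
    and "\<beta> \<equiv> J * f $ 1 + p * ((f $ 0)\<^sup>2 + f $ 1)"
  shows "somos5_with_integral \<alpha> \<beta> J (tau (fps_nth f))"
proof -
  obtain F a P where F0: "F 0 = f"
    and step: "\<And>n. stieltjes_step (fps_nth (F n)) (fps_nth (F (Suc n)))"
    and a: "\<And>n. F n $ 0 = a n" and P0: "P 0 = p"
    and P_Suc: "\<And>n. P (Suc n) = a n + a (Suc n) - J"
    and aP: "\<And>n. a (Suc n) * P (Suc (Suc n)) = a n * P n"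
    by (rule stieltjes_chain[OF quad nz]) blast
  have f1: "f $ Suc 0 = a 0 * a (Suc 0)"
  proof -
    have "F 0 $ Suc 0 = F 0 $ 0 * F 1 $ 0" using step[of 0] by (simp add: stieltjes_step_def)
    then show ?thesis by (metis F0 a One_nat_def)
  qed
  have f0: "f $ 0 = a 0" using a[of 0] F0 by simp
  note inv = qrt_invariants[OF P_Suc P_Suc aP]
  have \<alpha>_eq: "\<alpha> = - (a n * (P n + a (Suc n)))" for n
  proof (induction n)
    case 0
    show ?case by (simp add: \<alpha>_def f0 f1 P0 algebra_simps)
  next
    case (Suc n)
    then show ?case unfolding inv(1)[of n] .
  qed
  have \<beta>_eq: "\<beta> = a n * (a (Suc n) * J + (a n + a (Suc n)) * P n)" for n
  proof (induction n)
    case 0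
    show ?case by (simp add: \<beta>_def f0 f1 P0 algebra_simps power2_eq_square)
  next
    case (Suc n)
    then show ?case unfolding inv(2)[of n] .
  qed
  have ratio: "tau (fps_nth f) (n + 3) * tau (fps_nth f) n
      = a n * tau (fps_nth f) (n + 2) * tau (fps_nth f) (n + 1)" for n
    using tau_ratio[of "\<lambda>n. fps_nth (F n)" 0 n] step by (simp add: F0 a)
  have abc: "a n * a (Suc n) * a (Suc (Suc n)) = \<alpha> * a (Suc n) + \<beta>" for n
    unfolding \<alpha>_eq[of n] \<beta>_eq[of n] by (rule inv)
  \<comment> \<open>With both coefficients expanded at the same \<open>n\<close>, this is an
    identity in \<open>a n\<close>, \<open>a (Suc n)\<close>, \<open>P n\<close> and
    \<open>J\<close>.\<close>
  have abJ: "a n * a (Suc n) * J = a n * a (Suc n) * (a n + a (Suc n)) + \<alpha> * (a n + a (Suc n)) + \<beta>" for n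
    unfolding \<alpha>_eq[of n] \<beta>_eq[of n] by (simp add: algebra_simps)
  show ?thesis
    unfolding somos5_with_integral_def
  proof
    fix n
    let ?T = "tau (fps_nth f)"
    have r1: "?T (n+4) * ?T (n+1) = a (Suc n) * ?T (n+3) * ?T (n+2)"
      using ratio[of "n+1"] by (simp add: numeral_eq_Suc)
    have r2: "?T (n+5) * ?T (n+2) = a (Suc (Suc n)) * ?T (n+4) * ?T (n+3)"
      using ratio[of "n+2"] by (simp add: numeral_eq_Suc)
    show "?T (n+5) * ?T n = \<alpha> * ?T (n+4) * ?T (n+1) + \<beta> * ?T (n+3) * ?T (n+2) \<and>
     ?T n * ?T (n+1) * ?T (n+2) * ?T (n+3) * ?T (n+4) * J =
       (?T n)^2 * (?T (n+3))^2 * ?T (n+4) + ?T n * (?T (n+1))^2 * (?T (n+4))^2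
       + \<alpha> * ((?T (n+1))^2 * (?T (n+2))^2 * ?T (n+4) + ?T n * (?T (n+2))^2 * (?T (n+3))^2)
       + \<beta> * ?T (n+1) * (?T (n+2))^3 * ?T (n+3)"
      using somos5_window[OF ratio r1 r2 nz abc abJ] by blast
  qed
qed

section \<open>Moment sequences and their transport along ring homomorphisms\<close>

definition moments :: "'a::comm_ring_1 \<Rightarrow> 'a \<Rightarrow> (nat \<Rightarrow> 'a) \<Rightarrow> bool" where
  "moments k1 k2 s \<longleftrightarrow> (\<forall>j\<ge>3. s j = k1 * s (j - 1) + (\<Sum>i=1..j-1. s i * s (j - i))
            + k2 * (\<Sum>i=1..j-2. s i * s (j - i - 1)))"

text \<open>Provides moments over the lifted parameters. The value at 0 is a filler: the recursion
  refers only to indices from 1 on.\<close>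

fun moment_seq :: "'a::comm_ring_1 \<Rightarrow> 'a \<Rightarrow> 'a \<Rightarrow> 'a \<Rightarrow> nat \<Rightarrow> 'a" where
  "moment_seq k1 k2 s1 s2 j = (if j < 2 then s1 else if j = 2 then s2 else
     k1 * moment_seq k1 k2 s1 s2 (j - 1)
     + (\<Sum>i=1..j-1. moment_seq k1 k2 s1 s2 i * moment_seq k1 k2 s1 s2 (j - i))
     + k2 * (\<Sum>i=1..j-2. moment_seq k1 k2 s1 s2 i * moment_seq k1 k2 s1 s2 (j - i - 1)))"

declare moment_seq.simps [simp del]

lemma moment_seq_init [simp]:
  "moment_seq k1 k2 s1 s2 (Suc 0) = s1" "moment_seq k1 k2 s1 s2 2 = s2"
  by (simp_all add: moment_seq.simps)

lemma moments_moment_seq: "moments k1 k2 (moment_seq k1 k2 s1 s2)"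
  unfolding moments_def by (intro allI impI) (subst moment_seq.simps, simp)

lemma moments_unique:
  assumes s: "moments k1 k2 s" and t: "moments k1 k2 t" and init: "s 1 = t 1" "s 2 = t 2"
    and "j \<ge> 1"
  shows "s j = t j"
  using \<open>j \<ge> 1\<close>
proof (induction j rule: less_induct)
  case (less j)
  consider "j = 1" | "j = 2" | "j \<ge> 3" using less.prems by linarith
  then show ?case
  proof cases
    case 3
    have IH: "s i = t i" if "1 \<le> i" "i < j" for i using less.IH that by blast
    have "s j = k1 * s (j - 1) + (\<Sum>i=1..j-1. s i * s (j - i))
            + k2 * (\<Sum>i=1..j-2. s i * s (j - i - 1))"
      using s 3 by (simp add: moments_def)
    also have "\<dots> = k1 * t (j - 1) + (\<Sum>i=1..j-1. t i * t (j - i))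
            + k2 * (\<Sum>i=1..j-2. t i * t (j - i - 1))"
      using 3 by (intro arg_cong2[where f = "(+)"] arg_cong2[where f = "(*)"] sum.cong refl IH) auto
    also have "\<dots> = t j"
      using t 3 by (simp add: moments_def)
    finally show ?thesis .
  qed (use init in simp_all)
qed

context comm_ring_hom
begin

lemma hom_moments:
  assumes "moments k1 k2 s"
  shows "moments (hom k1) (hom k2) (\<lambda>j. hom (s j))"
  using assms unfolding moments_def
  by (auto simp: hom_distribs)

lemma hom_tau: "tau (\<lambda>j. hom (f j)) = (\<lambda>n. hom (tau f n))"
  unfolding tau_def hankel_det_def hom_det[symmetric] fun_eq_iff
  by (intro allI arg_cong[where f = det] eq_matI) auto

lemma hom_somos5_with_integral:
  assumes "somos5_with_integral \<alpha> \<beta> J T"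
  shows "somos5_with_integral (hom \<alpha>) (hom \<beta>) (hom J) (\<lambda>n. hom (T n))"
  using assms unfolding somos5_with_integral_def
  by (simp flip: hom_mult hom_add hom_power)

end

text \<open>Serves to descend from the fraction field to polynomials: both clauses are polynomial
  identities, which injectivity reflects.\<close>

lemma (in inj_comm_ring_hom) hom_somos5_with_integral_iff:
  "somos5_with_integral (hom \<alpha>) (hom \<beta>) (hom J) (\<lambda>n. hom (T n)) \<longleftrightarrow> somos5_with_integral \<alpha> \<beta> J T"
  unfolding somos5_with_integral_def
  by (simp flip: hom_mult hom_add hom_power)

section \<open>Generating function of the moments, the field case and Catalan moments\<close>

lemma moments_quad:
  fixes s :: "nat \<Rightarrow> 'a::field"
  assumes "moments k1 k2 s"
  shows "quad (k1 + 2 * s 1) k2 (s 1) (s 2 - k1 * s 1 - (s 1)\<^sup>2) (Abs_fps (\<lambda>j. s (Suc j)))"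
proof -
  define f where "f = Abs_fps (\<lambda>j. s (Suc j))"
  define c where "c = s 2 - k1 * s 1 - (s 1)\<^sup>2"
  have f: "f $ n = s (Suc n)" for n by (simp add: f_def)
  \<comment> \<open>Both convolution sums of the recursion are coefficients of
    \<open>f\<^sup>2\<close>.\<close>
  have sq: "(f\<^sup>2) $ n = (\<Sum>i=1..Suc n. s i * s (Suc (Suc n) - i))" for n
  proof -
    have "(f\<^sup>2) $ n = (\<Sum>i=0..n. s (Suc i) * s (Suc (n - i)))"
      by (simp add: power2_eq_square fps_mult_nth f)
    also have "\<dots> = (\<Sum>i=1..Suc n. s i * s (Suc (Suc n) - i))"
      unfolding One_nat_def sum.shift_bounds_cl_Suc_ivl by (intro sum.cong) (auto simp: Suc_diff_le)
    finally show ?thesis .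
  qed
  \<comment> \<open>The linear coefficient \<open>J - 2 * a\<close> with \<open>a = s 1\<close> is
    \<open>k1\<close>, whence \<open>J = k1 + 2 * s 1\<close>. Order x forces the value of
    \<open>c\<close>, and the orders from x^2 on are the recursion.\<close>
  define E where "E = fps_X * (f\<^sup>2 + fps_const k2 * (fps_X * f\<^sup>2)) - f + fps_X * (fps_const k1 * f)
    + fps_const (s 1) + fps_X * fps_const c"
  have "E $ n = 0" for n
  proof -
    consider "n = 0" | "n = 1" | m where "n = Suc (Suc m)" by (metis One_nat_def not0_implies_Suc)
    then show ?thesis
    proof cases
      case 1
      then show ?thesis by (simp add: E_def f)
    next
      case 2
      then show ?thesis
        by (simp add: E_def f c_def power2_eq_square fps_mult_nth_0 numeral_2_eq_2)
    next
      case 3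
      have "E $ n = (f\<^sup>2) $ (Suc m) + k2 * (f\<^sup>2) $ m - s (Suc (Suc (Suc m))) + k1 * s (Suc (Suc m))"
        by (simp add: E_def f 3)
      also have "s (Suc (Suc (Suc m))) = k1 * s (Suc (Suc m)) + (f\<^sup>2) $ (Suc m) + k2 * (f\<^sup>2) $ m"
        using assms[unfolded moments_def, rule_format, of "Suc (Suc (Suc m))"] by (simp add: sq)
      finally show ?thesis by simp
    qed
  qed
  then have "E = 0" by (intro fps_ext) simp
  then show ?thesis
    unfolding quad_def f_def[symmetric] c_def[symmetric]
    by (simp add: E_def algebra_simps)
qed

text \<open>Closed forms valid in any commutative ring; over the dual numbers their components are
  the prescribed formulas for \<alpha> and \<beta>.\<close>

definition somos_alpha :: "'a::comm_ring_1 \<Rightarrow> 'a \<Rightarrow> 'a \<Rightarrow> 'a" where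
  "somos_alpha k2 s1 s2 = - k2 * s1 - s2"

definition somos_beta :: "'a::comm_ring_1 \<Rightarrow> 'a \<Rightarrow> 'a \<Rightarrow> 'a \<Rightarrow> 'a" where
  "somos_beta k1 k2 s1 s2 = k2 * s2 + k1 * s2 + k2 * s1^2 + 2 * s1 * s2"

lemma moments_somos5_field:
  fixes s :: "nat \<Rightarrow> 'a::field"
  assumes "moments k1 k2 s" and nz: "\<And>m. tau (\<lambda>j. s (Suc j)) m \<noteq> 0"
  shows "somos5_with_integral (somos_alpha k2 (s 1) (s 2)) (somos_beta k1 k2 (s 1) (s 2)) (k1 + 2 * s 1)
    (tau (\<lambda>j. s (Suc j)))"
proof -
  let ?f = "Abs_fps (\<lambda>j. s (Suc j))"
  have nth: "fps_nth ?f = (\<lambda>j. s (Suc j))" by (simp add: fun_eq_iff)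
  have "quad (k1 + 2 * s 1) k2 (?f $ 0) (s 2 - k1 * s 1 - (s 1)\<^sup>2) ?f"
    using moments_quad[OF assms(1)] by simp
  from hankel_somos5_field[OF this] nz show ?thesis
    by (simp add: nth somos_alpha_def somos_beta_def numeral_2_eq_2 algebra_simps)
qed

text \<open>The generating function satisfies \<open>f = 1 / (1 - x f)\<close>: it is its own tail
  with leading coefficient 1, so \<open>tau_Suc_step\<close> makes \<open>tau\<close>
  constant.\<close>

lemma moments_catalan:
  fixes s :: "nat \<Rightarrow> 'a::comm_ring_1"
  assumes m: "moments 0 0 s" and s: "s 1 = 1" "s 2 = 1"
  shows "tau (\<lambda>j. s (Suc j)) n = 1"
proof -
  let ?f = "\<lambda>j. s (Suc j)"
  have "stieltjes_step ?f ?f"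
    unfolding stieltjes_step_def
  proof
    fix n
    show "s (Suc (Suc n)) = (\<Sum>m\<le>n. s (Suc (n - m)) * s (Suc m))"
    proof (cases n)
      case 0
      then show ?thesis using s by (simp add: numeral_2_eq_2)
    next
      case (Suc k)
      have "s (Suc (Suc n)) = (\<Sum>i=1..Suc n. s i * s (Suc (Suc n) - i))"
        using m Suc by (simp add: moments_def)
      also have "\<dots> = (\<Sum>m\<le>n. s (Suc (n - m)) * s (Suc m))"
        unfolding One_nat_def sum.shift_bounds_cl_Suc_ivl atLeast0AtMost
        by (intro sum.cong) (auto simp: Suc_diff_le mult.commute)
      finally show ?thesis .
    qed
  qed
  from tau_Suc_step[OF this] show ?thesis
    using s(1) by (induction n) simp_all
qed

section \<open>Descent from C(t) through C[t] to the dual numbers C[t]/(t^2)\<close>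

definition trunc_dual :: "complex poly \<Rightarrow> dual" where
  "trunc_dual p = Dual (coeff p 0) (coeff p 1)"

interpretation trunc_dual: comm_ring_hom trunc_dual
  by unfold_locales
    (simp_all add: trunc_dual_def zero_dual_def one_dual_def plus_dual_def times_dual_def coeff_mult add.commute)

interpretation eval_one: comm_ring_hom "\<lambda>p. poly p (1 :: complex)"
  by unfold_locales simp_all

interpretation to_fract: inj_comm_ring_hom "to_fract :: complex poly \<Rightarrow> _"
  by unfold_locales simp_all

definition dual_lift :: "complex \<Rightarrow> dual \<Rightarrow> complex poly" where
  "dual_lift v a = [:std_part a, eps_part a, v - std_part a - eps_part a:]"

lemma trunc_dual_lift [simp]: "trunc_dual (dual_lift v a) = a"
  by (simp add: trunc_dual_def dual_lift_def)

lemma poly_dual_lift [simp]: "poly (dual_lift v a) 1 = v"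
  by (simp add: dual_lift_def)

lemma moments_somos5_dual:
  fixes s :: "nat \<Rightarrow> dual"
  assumes s: "moments k1 k2 s"
  shows "somos5_with_integral (somos_alpha k2 (s 1) (s 2)) (somos_beta k1 k2 (s 1) (s 2)) (k1 + 2 * s 1)
    (tau (\<lambda>j. s (Suc j)))"
proof -
  define l1 l2 t1 t2 where "l1 = dual_lift 0 k1" and "l2 = dual_lift 0 k2"
    and "t1 = dual_lift 1 (s 1)" and "t2 = dual_lift 1 (s 2)"
  define t where "t = moment_seq l1 l2 t1 t2"
  have t: "moments l1 l2 t" "t 1 = t1" "t 2 = t2" by (simp_all add: t_def moments_moment_seq)
  let ?T = "tau (\<lambda>j. t (Suc j))"
  \<comment> \<open>At t = 1 the lifted data become 0, 0, 1, 1, so evaluation sends the lifted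
    moments to the Catalan case.\<close>
  have "poly (?T m) 1 = 1" for m
    using eval_one.hom_moments[OF t(1)] unfolding eval_one.hom_tau[THEN fun_cong, symmetric]
    by (intro moments_catalan) (simp_all add: l1_def l2_def t t1_def t2_def del: One_nat_def)
  then have nz: "?T m \<noteq> 0" for m by (metis poly_0 zero_neq_one)
  have "somos5_with_integral (somos_alpha (to_fract l2) (to_fract t1) (to_fract t2))
      (somos_beta (to_fract l1) (to_fract l2) (to_fract t1) (to_fract t2)) (to_fract l1 + 2 * to_fract t1)
      (tau (\<lambda>j. to_fract (t (Suc j))))"
    using moments_somos5_field[OF to_fract.hom_moments[OF t(1)]] nz t(2,3)
    by (simp add: to_fract.hom_tau)
  then have "somos5_with_integral (somos_alpha l2 t1 t2) (somos_beta l1 l2 t1 t2) (l1 + 2 * t1) ?T"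
    unfolding to_fract.hom_somos5_with_integral_iff[symmetric]
    by (simp add: to_fract.hom_tau somos_alpha_def somos_beta_def hom_distribs)
  from trunc_dual.hom_somos5_with_integral[OF this]
  have "somos5_with_integral (somos_alpha k2 (s 1) (s 2)) (somos_beta k1 k2 (s 1) (s 2)) (k1 + 2 * s 1)
      (tau (\<lambda>j. trunc_dual (t (Suc j))))"
    by (simp add: trunc_dual.hom_tau somos_alpha_def somos_beta_def hom_distribs l1_def l2_def t1_def t2_def)
  \<comment> \<open>Modulo t^2 the lifted moments obey the recursion of \<open>s\<close> with the
    same first two terms.\<close>
  moreover have "(\<lambda>j. trunc_dual (t (Suc j))) = (\<lambda>j. s (Suc j))"
  proof
    fix j
    have "moments k1 k2 (\<lambda>j. trunc_dual (t j))"
      using trunc_dual.hom_moments[OF t(1)] by (simp add: l1_def l2_def)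
    from moments_unique[OF this s] show "trunc_dual (t (Suc j)) = s (Suc j)"
      using t by (simp add: t1_def t2_def)
  qed
  ultimately show ?thesis by simp
qed

section \<open>Reindexing from \<open>tau\<close> to \<Delta>, and uniqueness of the first
  integral\<close>

theorem proposition5p3:
  fixes k1 k2 \<alpha> \<beta> :: dual and s :: "nat \<Rightarrow> dual" and \<Delta> :: "int \<Rightarrow> dual"
  assumes s1: "s 1 \<in> dual_units" and s2: "s 2 \<in> dual_units"
    and s_rec: "\<And>j. j \<ge> 3 \<Longrightarrow>
      s j = k1 * s (j - 1) + (\<Sum>i=1..j-1. s i * s (j - i))
            + k2 * (\<Sum>i=1..j-2. s i * s (j - i - 1))"
    and \<Delta>_init: "\<Delta> (-2) = 1" "\<Delta> (-1) = 1" "\<Delta> 0 = 1"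
    and \<Delta>_odd: "\<And>k::nat. k \<ge> 1 \<Longrightarrow>
      \<Delta> (2 * int k - 1) = det (mat k k (\<lambda>(i, j). s ((i + 1) + (j + 1) - 1)))"
    and \<Delta>_even: "\<And>k::nat. k \<ge> 1 \<Longrightarrow>
      \<Delta> (2 * int k) = det (mat k k (\<lambda>(i, j). s ((i + 1) + (j + 1))))"
    and \<alpha>0: "std_part \<alpha> = - std_part k2 * std_part (s 1) - std_part (s 2)"
    and \<beta>0: "std_part \<beta> = std_part k2 * std_part (s 2) + std_part k1 * std_part (s 2)
      + std_part k2 * (std_part (s 1))^2 + 2 * std_part (s 1) * std_part (s 2)"
    and \<alpha>1: "eps_part \<alpha> = - std_part k2 * eps_part (s 1) - eps_part k2 * std_part (s 1)
      - eps_part (s 2)"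
    and \<beta>1: "eps_part \<beta> = std_part k2 * eps_part (s 2) + eps_part k2 * std_part (s 2)
      + eps_part k1 * std_part (s 2) + std_part k1 * eps_part (s 2)
      + eps_part k2 * (std_part (s 1))^2 + 2 * std_part k2 * eps_part (s 1) * std_part (s 1)
      + 2 * eps_part (s 1) * std_part (s 2) + 2 * std_part (s 1) * eps_part (s 2)"
  shows "(\<forall>n\<ge>0. \<Delta> (n + 3) * \<Delta> (n - 2) = \<alpha> * \<Delta> (n + 2) * \<Delta> (n - 1) + \<beta> * \<Delta> (n + 1) * \<Delta> n)
    \<and> (\<exists>!J. somos5_first_integral \<alpha> \<beta> (-2) \<Delta> J)
    \<and> (\<forall>J. somos5_first_integral \<alpha> \<beta> (-2) \<Delta> J \<longrightarrow>
          std_part J = std_part k1 + 2 * std_part (s 1) \<and>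
          eps_part J = eps_part k1 + 2 * eps_part (s 1))"
proof -
  define T where "T = tau (\<lambda>j. s (Suc j))"
  have \<alpha>: "\<alpha> = somos_alpha k2 (s 1) (s 2)"
    by (simp add: \<alpha>0 \<alpha>1 dual_eq_iff somos_alpha_def plus_dual_def minus_dual_def uminus_dual_def
        times_dual_def)
  have two: "(2 :: dual) = Dual 2 0"
    unfolding one_add_one[symmetric] one_dual_def plus_dual_def by simp
  have \<beta>: "\<beta> = somos_beta k1 k2 (s 1) (s 2)"
    by (simp add: \<beta>0 \<beta>1 dual_eq_iff somos_beta_def two power2_eq_square plus_dual_def
        times_dual_def algebra_simps)
  define J0 where "J0 = k1 + 2 * s 1"
  have J0: "std_part J0 = std_part k1 + 2 * std_part (s 1)" "eps_part J0 = eps_part k1 + 2 * eps_part (s 1)"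
    by (simp_all add: J0_def two plus_dual_def times_dual_def)
  have "moments k1 k2 s"
    unfolding moments_def using s_rec by blast
  from moments_somos5_dual[OF this]
  have som: "somos5_with_integral \<alpha> \<beta> J0 T"
    unfolding \<alpha> \<beta> J0_def T_def .
  \<comment> \<open>The determinant formula starts at \<open>k = 1\<close>; at \<open>k = 0\<close>
    the initial value \<open>\<Delta> (-1)\<close> meets an empty determinant.\<close>
  have odd: "\<Delta> (2 * int k - 1) = T (2 * k + 1)" for k
  proof (cases "k = 0")
    case False
    then show ?thesis
      using \<Delta>_odd[of k] by (simp add: T_def tau_def hankel_det_def)
  qed (simp add: T_def \<Delta>_init)
  have even: "\<Delta> (2 * int k) = T (2 * k + 2)" for k
  proof (cases "k = 0")
    case False
    then show ?thesis
      using \<Delta>_even[of k] by (simp add: T_def tau_def hankel_det_def)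
  qed (simp add: T_def tau_def hankel_det_def \<Delta>_init)
  have \<Delta>_T: "\<Delta> (int m - 2) = T m" for m
  proof -
    \<comment> \<open>The case \<open>m = 0\<close> stands for \<open>\<Delta> (-2)\<close>, which
      lies below the range of both index formulas.\<close>
    consider "m = 0" | k where "m = 2 * k + 1" | k where "m = 2 * k + 2"
    proof (cases "even m")
      case True
      then obtain l where l: "m = 2 * l" by (rule evenE)
      show thesis
      proof (cases l)
        case 0
        with l show thesis by (intro that(1)) simp
      next
        case (Suc k)
        with l show thesis by (intro that(3)[of k]) simp
      qed
    next
      case False
      then show thesis using that(2) by (elim oddE)
    qed
    then show ?thesis
    proof cases
      case 1
      then show ?thesis by (simp add: T_def \<Delta>_init)
    next
      case (2 k)
      then have "int m - 2 = 2 * int k - 1" by simp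
      then show ?thesis using odd[of k] 2 by (simp only:)
    next
      case (3 k)
      then have "int m - 2 = 2 * int k" by simp
      then show ?thesis using even[of k] 3 by (simp only:)
    qed
  qed
  have \<Delta>_eq: "\<Delta> n = T m" if "n + 2 = int m" for n m
    using \<Delta>_T[of m] that[symmetric] by simp
  have recurrence: "\<Delta> (n + 3) * \<Delta> (n - 2) = \<alpha> * \<Delta> (n + 2) * \<Delta> (n - 1) + \<beta> * \<Delta> (n + 1) * \<Delta> n"
    if "n \<ge> 0" for n
  proof -
    define m where "m = nat n"
    have n: "n = int m" using that by (simp add: m_def)
    have "\<Delta> (n + 3) = T (m + 5)" "\<Delta> (n - 2) = T m" "\<Delta> (n + 2) = T (m + 4)"
      "\<Delta> (n - 1) = T (m + 1)" "\<Delta> (n + 1) = T (m + 3)" "\<Delta> n = T (m + 2)"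
      by (rule \<Delta>_eq, simp add: n)+
    then show ?thesis
      using som[unfolded somos5_with_integral_def, rule_format, of m] by simp
  qed
  have integral: "somos5_first_integral \<alpha> \<beta> (-2) \<Delta> J0"
    unfolding somos5_first_integral_def
  proof (intro allI impI)
    fix n :: int assume "n \<ge> -2"
    define m where "m = nat (n + 2)"
    have n: "n = int m - 2" using \<open>n \<ge> -2\<close> by (simp add: m_def)
    have shifts: "\<Delta> n = T m" "\<Delta> (n + 1) = T (m + 1)" "\<Delta> (n + 2) = T (m + 2)"
      "\<Delta> (n + 3) = T (m + 3)" "\<Delta> (n + 4) = T (m + 4)"
      by (rule \<Delta>_eq, simp add: n)+
    show "\<Delta> n * \<Delta> (n+1) * \<Delta> (n+2) * \<Delta> (n+3) * \<Delta> (n+4) * J0 =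
        (\<Delta> n)^2 * (\<Delta> (n+3))^2 * \<Delta> (n+4) + \<Delta> n * (\<Delta> (n+1))^2 * (\<Delta> (n+4))^2
        + \<alpha> * ((\<Delta> (n+1))^2 * (\<Delta> (n+2))^2 * \<Delta> (n+4) + \<Delta> n * (\<Delta> (n+2))^2 * (\<Delta> (n+3))^2)
        + \<beta> * \<Delta> (n+1) * (\<Delta> (n+2))^3 * \<Delta> (n+3)"
      unfolding shifts using som[unfolded somos5_with_integral_def, rule_format, of m] by blast
  qed
  have unique: "J = J0" if J: "somos5_first_integral \<alpha> \<beta> (-2) \<Delta> J" for J
  proof -
    have T34: "T 3 = s 1" "T 4 = s 2" by (simp_all add: T_def numeral_2_eq_2)
    have "\<Delta> 1 = s 1" "\<Delta> 2 = s 2"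
      using \<Delta>_eq[of 1 3] \<Delta>_eq[of 2 4] T34 by simp_all
    \<comment> \<open>The window at -2 is \<open>1, 1, 1, s 1, s 2\<close>, so the factor of
      \<open>J\<close> is a product of two units.\<close>
    then have "s 1 * s 2 * J = s 1 * s 2 * J0"
      using J[unfolded somos5_first_integral_def, rule_format, of "-2"]
        integral[unfolded somos5_first_integral_def, rule_format, of "-2"] \<Delta>_init by simp
    then have eq: "s 1 * (s 2 * J) = s 1 * (s 2 * J0)" by (simp only: mult.assoc)
    obtain v w where vw: "1 = s 1 * v" "1 = s 2 * w"
      using s1 s2 unfolding dual_units_iff_dvd_1 by (elim dvdE)
    \<comment> \<open>Dual numbers have zero divisors, so cancellation goes through explicit
      inverses.\<close>
    have cancel: "a = b" if "x * a = x * b" "1 = x * y" for x y a b :: dual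
    proof -
      have inverse: "y * (x * c) = c" for c
        using that(2) by (metis mult.assoc mult.commute mult_1)
      show ?thesis using that(1) by (metis inverse)
    qed
    show ?thesis by (rule cancel[OF cancel[OF eq vw(1)] vw(2)])
  qed
  show ?thesis
    using recurrence integral unique J0 by blast
qed

end
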